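(* For $n\ge 1$ let $\pi_n$ be the rank of the $\mathbb{Z}$-module $\Xi^n$. Then $\pi_1=1$, $\pi_2=1$, $\pi_3=2$, $\pi_4=4$, and $\pi_n=\pi_{n-1}+\pi_{n-2}+\pi_{n-4}$ for all $n\ge 5$.
   Context: A composition $\alpha=[\alpha_1,\ldots,\alpha_k]$ of $n$ ($\alpha\vDash n$) is an ordered list of positive integers summing to $n$; $k(\alpha)=k$; $I(\alpha)=\{\alpha_1,\alpha_1+\alpha_2,\ldots,\alpha_1+\cdots+\alpha_{k-1}\}\subset[n-1]$, $A+1=\{a+1:a\in A\}$. $M_\alpha=\sum_{i_1<\cdots<i_k}x_{i_1}^{\alpha_1}\cdots x_{i_k}^{\alpha_k}$. For $\alpha\vDash n$, $\theta_\alpha=\sum_{\beta\vDash n,\ I(\alpha)\subset I(\beta)\cup(I(\beta)+1)}2^{k(\beta)}M_\beta$. $\theta_\alpha$ ($\alpha\vDash n$) is a shifted quasi-symmetric function if $n\le 1$ or $\alpha_1>1$. $\Xi^n$ is the $\mathbb{Z}$-module spanned by all shifted quasi-symmetric functions $\theta_\alpha$ with $\alpha\vDash n$. *)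

theory Defs
  imports Complex_Main "HOL-Library.Poly_Mapping" "HOL-Library.Function_Algebras"
    "HOL-Library.Extended_Nat"
begin

text \<open>Formal power series with integer coefficients in the variables \<open>x\<^sub>1, x\<^sub>2, \<dots>\<close>:
  a monomial is its finitely supported exponent function, and a series is its coefficient function.
  Addition is the pointwise addition of \<^theory>\<open>HOL-Library.Function_Algebras\<close>.\<close>

type_synonym monomial = "nat \<Rightarrow>\<^sub>0 nat"
type_synonym series = "monomial \<Rightarrow> int"

definition smul :: "int \<Rightarrow> series \<Rightarrow> series" where
  "smul c f = (\<lambda>m. c * f m)"

lemma module_smul: "module smul"
  by unfold_locales (auto simp: smul_def fun_eq_iff algebra_simps)

definition composition :: "nat \<Rightarrow> nat list \<Rightarrow> bool" where
  "composition n \<alpha> \<longleftrightarrow> (\<forall>a \<in> set \<alpha>. a > 0) \<and> sum_list \<alpha> = n"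

definition I :: "nat list \<Rightarrow> nat set" where
  "I \<alpha> = {sum_list (take j \<alpha>) | j. 1 \<le> j \<and> j < length \<alpha>}"

text \<open>The coefficient of \<open>m\<close> in \<open>M \<alpha>\<close> counts the sequences \<open>0 < i\<^sub>1 < \<dots> < i\<^sub>k\<close> whose monomial
  is \<open>m\<close>. There is at most one such sequence when all parts of \<open>\<alpha>\<close> are positive.\<close>

definition M :: "nat list \<Rightarrow> series" where
  "M \<alpha> = (\<lambda>m. int (card {is. length is = length \<alpha> \<and> sorted_wrt (<) is \<and> (\<forall>i \<in> set is. i \<ge> 1)
      \<and> sum_list (map2 Poly_Mapping.single is \<alpha>) = m}))"

text \<open>The sum defining \<open>\<theta>\<close> is over a finite set by the following lemma.\<close>

lemma finite_compositions: "finite {\<beta>. composition n \<beta>}"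
proof (rule finite_subset)
  show "{\<beta>. composition n \<beta>} \<subseteq> {\<beta>. set \<beta> \<subseteq> {..n} \<and> length \<beta> \<le> n}"
  proof
    fix \<beta> assume "\<beta> \<in> {\<beta>. composition n \<beta>}"
    then have pos: "\<forall>a \<in> set \<beta>. a > 0" and s: "sum_list \<beta> = n"
      by (auto simp: composition_def)
    have "length \<beta> \<le> sum_list \<beta>"
      using pos by (induction \<beta>) auto
    with s show "\<beta> \<in> {\<beta>. set \<beta> \<subseteq> {..n} \<and> length \<beta> \<le> n}"
      using member_le_sum_list by fastforce
  qed
  show "finite {\<beta>. set \<beta> \<subseteq> {..n} \<and> length \<beta> \<le> n}"
    by (rule finite_lists_length_le) simp
qed

definition \<theta> :: "nat list \<Rightarrow> series" where
  "\<theta> \<alpha> = (\<Sum>\<beta> | composition (sum_list \<alpha>) \<beta> \<and> I \<alpha> \<subseteq> I \<beta> \<union> (\<lambda>a. a + 1) ` I \<beta>.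
             smul (2 ^ length \<beta>) (M \<beta>))"

definition shifted_qsym :: "nat \<Rightarrow> series set" where
  "shifted_qsym n = {\<theta> \<alpha> | \<alpha>. composition n \<alpha> \<and> (n \<le> 1 \<or> hd \<alpha> > 1)}"

definition \<Xi> :: "nat \<Rightarrow> series set" where
  "\<Xi> n = module.span smul (shifted_qsym n)"

text \<open>The rank of a \<open>\<int>\<close>-submodule is the largest number of linearly independent elements. It is
  taken in \<^typ>\<open>enat\<close>, so that a submodule of infinite rank does not receive an arbitrary
  natural number.\<close>

definition rank :: "series set \<Rightarrow> enat" where
  "rank V = (SUP B \<in> {B. finite B \<and> B \<subseteq> V \<and> \<not> module.dependent smul B}. enat (card B))"

definition \<pi> :: "nat \<Rightarrow> enat" where
  "\<pi> n = rank (\<Xi> n)"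

end

theory Submission imports Defs begin

text \<open>Group the monomial quasi-symmetric functions \<open>M \<beta>\<close>, \<open>\<beta> \<Turnstile> n\<close>, according to the trace \<open>U\<close> of
  \<open>I \<beta> \<union> (I \<beta> + 1)\<close> on \<open>{2..<n}\<close>. The functions \<open>\<theta> \<alpha>\<close> with \<open>1 \<notin> I \<alpha>\<close> are exactly the sums of
  these blocks over all traces containing a given subset of \<open>{2..<n}\<close>. By inclusion-exclusion the
  blocks lie in \<open>\<Xi> n\<close>, so they form a \<open>\<int>\<close>-basis, and the rank is the number of traces. A trace is
  built up by deciding one element at a time, and keeping track of whether \<open>n - 1\<close> is in the
  underlying set gives a linear recursion for their number.\<close>

section \<open>Rank of a free submodule\<close>

interpretation Z: module smul
  by (rule module_smul)

text \<open>Bounding the size of independent sets by exchange requires division, so integer series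
  are embedded into the rational vector space \<open>Q\<close>.\<close>

interpretation Q: vector_space "\<lambda>(c::rat) (f::monomial \<Rightarrow> rat) m. c * f m"
  by unfold_locales (auto simp: fun_eq_iff algebra_simps)

definition rat_series :: "series \<Rightarrow> monomial \<Rightarrow> rat" where
  "rat_series f = (\<lambda>m. of_int (f m))"

lemma inj_rat_series: "inj rat_series"
  by (auto simp: inj_def rat_series_def fun_eq_iff)

lemma sum_fun_apply: "sum f A x = (\<Sum>a\<in>A. f a x)"
  by (induction A rule: infinite_finite_induct) auto

lemma rat_series_in_span:
  assumes "f \<in> Z.span B"
  shows "rat_series f \<in> Q.span (rat_series ` B)"
  using assms
proof (induction rule: Z.span_induct_alt)
  case base
  have "rat_series 0 = 0" by (auto simp: rat_series_def fun_eq_iff)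
  then show ?case using Q.span_zero by metis
next
  case (step c x y)
  have "rat_series (smul c x + y) = (\<lambda>m. of_int c * rat_series x m) + rat_series y"
    by (auto simp: rat_series_def smul_def fun_eq_iff)
  moreover have "rat_series x \<in> rat_series ` B" using step(1) by (rule imageI)
  ultimately show ?case using step(2) by (simp only: Q.span_add Q.span_scale Q.span_base)
qed

text \<open>Serves to turn a rational linear relation into an integral one.\<close>

lemma common_denominator:
  assumes "finite C"
  shows "\<exists>d::int. d \<noteq> 0 \<and> (\<forall>c\<in>C. \<exists>k. of_int d * (u c :: rat) = of_int k)"
  using assms
proof (induction rule: finite_induct)
  case empty
  show ?case by (rule exI[of _ 1]) auto
next
  case (insert x C)
  then obtain d where d: "d \<noteq> 0" "\<forall>c\<in>C. \<exists>k. of_int d * u c = of_int k" by blast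
  obtain a b where ab: "u x = of_int a / of_int b" "b > 0"
    using quotient_of_div quotient_of_denom_pos by (metis prod.collapse)
  have "\<exists>k. of_int (b * d) * u c = of_int k" if c: "c \<in> insert x C" for c
  proof (cases "c = x")
    case True
    then have "of_int (b * d) * u c = of_int (d * a)" using ab by simp
    then show ?thesis by blast
  next
    case False
    then obtain k where "of_int d * u c = of_int k" using c d by blast
    then have "of_int (b * d) * u c = of_int (b * k)" by (simp add: mult.assoc)
    then show ?thesis by blast
  qed
  then show ?case using d ab by (intro exI[of _ "b * d"]) auto
qed

text \<open>Multiplying a rational relation by a common denominator \<open>d\<close> gives an
  integral relation between the original series, and a nonzero coefficient stays nonzero because
  \<open>d\<close> is nonzero.\<close>

lemma independent_rat_series:
  assumes fin: "finite C" and ind: "\<not> Z.dependent C"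
  shows "\<not> Q.dependent (rat_series ` C)"
proof
  assume "Q.dependent (rat_series ` C)"
  then obtain u v where v: "v \<in> C" "u (rat_series v) \<noteq> 0"
    and z: "(\<Sum>x\<in>rat_series ` C. (\<lambda>m. u x * x m)) = 0"
    unfolding Q.dependent_finite[OF finite_imageI[OF fin]] by auto
  obtain d where d: "d \<noteq> 0" "\<forall>c\<in>C. \<exists>k. of_int d * u (rat_series c) = of_int k"
    using common_denominator[OF fin, of "\<lambda>c. u (rat_series c)"] by blast
  then obtain k where k: "\<And>c. c \<in> C \<Longrightarrow> of_int d * u (rat_series c) = of_int (k c)"
    by metis
  have "(\<Sum>c\<in>C. smul (k c) c) = 0"
  proof
    fix m
    have "(of_int (\<Sum>c\<in>C. k c * c m) :: rat)
        = (\<Sum>c\<in>C. (of_int d * u (rat_series c)) * rat_series c m)"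
      unfolding of_int_sum by (intro sum.cong refl) (simp only: k, simp add: rat_series_def)
    also have "\<dots> = of_int d * (\<Sum>c\<in>C. u (rat_series c) * rat_series c m)"
      by (simp add: sum_distrib_left mult.assoc)
    also have "(\<Sum>c\<in>C. u (rat_series c) * rat_series c m)
        = (\<Sum>x\<in>rat_series ` C. (\<lambda>m. u x * x m)) m"
      by (simp add: sum_fun_apply sum.reindex[OF inj_on_subset[OF inj_rat_series]])
    also have "\<dots> = 0" using z by simp
    finally have "(\<Sum>c\<in>C. k c * c m) = 0" by (simp del: of_int_sum)
    then show "(\<Sum>c\<in>C. smul (k c) c) m = 0 m" by (simp add: sum_fun_apply smul_def)
  qed
  moreover have "k v \<noteq> 0" using k[OF v(1)] v(2) d(1) by (metis mult_eq_0_iff of_int_0 of_int_eq_iff)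
  ultimately show False using ind v(1) unfolding Z.dependent_finite[OF fin] by blast
qed

text \<open>The upper bound is the exchange lemma over the rationals, applied to the images of
  \<open>C\<close> and \<open>B\<close>; for the lower bound, \<open>B\<close> itself occurs in the
  supremum.\<close>

lemma rank_span:
  assumes fin: "finite B" and ind: "\<not> Z.dependent B"
  shows "rank (Z.span B) = enat (card B)"
  unfolding rank_def
proof (rule antisym)
  show "(SUP C \<in> {C. finite C \<and> C \<subseteq> Z.span B \<and> \<not> Z.dependent C}. enat (card C)) \<le> enat (card B)"
  proof (rule SUP_least)
    fix C assume "C \<in> {C. finite C \<and> C \<subseteq> Z.span B \<and> \<not> Z.dependent C}"
    then have C: "finite C" "C \<subseteq> Z.span B" "\<not> Z.dependent C" by auto
    have "card (rat_series ` C) \<le> card (rat_series ` B)"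
      using Q.independent_span_bound[of "rat_series ` B" "rat_series ` C"] fin
        independent_rat_series[OF C(1,3)] rat_series_in_span C(2) by blast
    then show "enat (card C) \<le> enat (card B)"
      by (simp add: card_image[OF inj_on_subset[OF inj_rat_series]])
  qed
  show "enat (card B) \<le> (SUP C \<in> {C. finite C \<and> C \<subseteq> Z.span B \<and> \<not> Z.dependent C}. enat (card C))"
    by (rule SUP_upper2[of B]) (use fin ind Z.span_superset in auto)
qed

section \<open>Monomial quasi-symmetric functions and compositions\<close>

text \<open>Distinct indices prevent exponents from merging and positive exponents prevent indices
  from vanishing, so the monomial determines both.\<close>

lemma keys_lookup_sum_list_single:
  assumes "length is = length \<alpha>" "distinct is" "\<forall>a\<in>set \<alpha>. (a::nat) > 0"
  shows "Poly_Mapping.keys (sum_list (map2 Poly_Mapping.single is \<alpha>)) = set is \<and>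
    map (Poly_Mapping.lookup (sum_list (map2 Poly_Mapping.single is \<alpha>))) is = \<alpha>"
  using assms
proof (induction "is" \<alpha> rule: list_induct2)
  case (Cons i "is" a \<alpha>)
  let ?m = "sum_list (map2 Poly_Mapping.single is \<alpha>)"
  from Cons have m: "Poly_Mapping.keys ?m = set is" "map (Poly_Mapping.lookup ?m) is = \<alpha>"
    and i: "i \<notin> set is" and a: "a > 0"
    by auto
  from i m have 0: "Poly_Mapping.lookup ?m i = 0" by (metis in_keys_iff)
  have l: "Poly_Mapping.lookup (Poly_Mapping.single i a + ?m) j =
      (if j = i then a else Poly_Mapping.lookup ?m j)" for j
    using 0 by (simp add: lookup_add lookup_single when_def)
  have "Poly_Mapping.keys (Poly_Mapping.single i a + ?m) = insert i (set is)"
    unfolding m(1)[symmetric] using a by (intro set_eqI) (simp add: in_keys_iff l)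
  moreover have "map (Poly_Mapping.lookup (Poly_Mapping.single i a + ?m)) is
      = map (Poly_Mapping.lookup ?m) is"
    using i by (intro map_cong refl) (auto simp: l)
  ultimately show ?case using l[of i] m(2) by simp
qed simp

text \<open>The monomial of M \<beta> in the first \<open>length \<beta>\<close> variables; its
  coefficient separates M \<beta> from every other M \<alpha>.\<close>

definition packed_monomial :: "nat list \<Rightarrow> monomial" where
  "packed_monomial \<beta> = sum_list (map2 Poly_Mapping.single [1..<Suc (length \<beta>)] \<beta>)"

lemma M_packed_monomial:
  assumes "\<forall>a\<in>set \<alpha>. a > 0" "\<forall>a\<in>set \<beta>. a > 0"
  shows "M \<alpha> (packed_monomial \<beta>) = (if \<alpha> = \<beta> then 1 else 0)"
proof -
  have \<beta>: "Poly_Mapping.keys (packed_monomial \<beta>) = set [1..<Suc (length \<beta>)]"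
    "map (Poly_Mapping.lookup (packed_monomial \<beta>)) [1..<Suc (length \<beta>)] = \<beta>"
    using keys_lookup_sum_list_single[of "[1..<Suc (length \<beta>)]" \<beta>] assms(2)
    by (simp_all add: packed_monomial_def del: upt_Suc)
  let ?A = "{is. length is = length \<alpha> \<and> sorted_wrt (<) is \<and> (\<forall>i \<in> set is. i \<ge> 1)
      \<and> sum_list (map2 Poly_Mapping.single is \<alpha>) = packed_monomial \<beta>}"
  have A: "is = [1..<Suc (length \<beta>)] \<and> \<alpha> = \<beta>" if "is \<in> ?A" for "is"
  proof -
    have s: "sorted is" "distinct is" and "length is = length \<alpha>"
      and m: "sum_list (map2 Poly_Mapping.single is \<alpha>) = packed_monomial \<beta>"
      using that by (auto simp: strict_sorted_iff)
    with keys_lookup_sum_list_single[of "is" \<alpha>] assms(1)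
    have \<alpha>: "Poly_Mapping.keys (packed_monomial \<beta>) = set is"
      "map (Poly_Mapping.lookup (packed_monomial \<beta>)) is = \<alpha>"
      by auto
    \<comment> \<open>A strictly increasing index list is the sorted enumeration of the support of
      its monomial, so the support leaves only one candidate.\<close>
    have "is = [1..<Suc (length \<beta>)]"
      using s \<alpha>(1) \<beta>(1) by (intro sorted_distinct_set_unique) (simp_all del: upt_Suc)
    then show ?thesis using \<alpha>(2) \<beta>(2) by metis
  qed
  show ?thesis
  proof (cases "\<alpha> = \<beta>")
    case True
    then have "[1..<Suc (length \<beta>)] \<in> ?A"
      by (auto simp: packed_monomial_def simp del: upt_Suc)
    with A have "?A = {[1..<Suc (length \<beta>)]}" by blast
    then show ?thesis unfolding M_def using True by simp
  next
    case False
    with A have empty: "?A = {}" by blast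
    show ?thesis unfolding M_def empty using False by simp
  qed
qed

section \<open>Compositions and their sets of proper partial sums\<close>

lemma I_eq_image: "I \<alpha> = (\<lambda>j. sum_list (take j \<alpha>)) ` {1..<length \<alpha>}"
  by (auto simp: I_def)

text \<open>The old total becomes a proper partial sum. For \<alpha> = [] this would wrongly insert
  0.\<close>

lemma I_append:
  assumes "\<alpha> \<noteq> []"
  shows "I (\<alpha> @ [b]) = insert (sum_list \<alpha>) (I \<alpha>)"
proof -
  have "I (\<alpha> @ [b]) = (\<lambda>j. sum_list (take j (\<alpha> @ [b]))) ` {1..length \<alpha>}"
    by (simp only: I_eq_image length_append) (simp add: atLeastLessThanSuc_atLeastAtMost)
  also have "\<dots> = (\<lambda>j. sum_list (take j \<alpha>)) ` {1..length \<alpha>}"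
    by (intro image_cong) auto
  also have "{1..length \<alpha>} = insert (length \<alpha>) {1..<length \<alpha>}"
    using assms by (auto simp: Suc_le_eq)
  also have "(\<lambda>j. sum_list (take j \<alpha>)) ` \<dots> = insert (sum_list \<alpha>) (I \<alpha>)"
    by (simp add: I_eq_image)
  finally show ?thesis .
qed

text \<open>Induction by removing the largest element s of S: a composition of s realizes the
  remaining elements, and the part n - s is appended.\<close>

lemma composition_with_partial_sums:
  assumes "n \<ge> 1" "S \<subseteq> {1..<n}"
  shows "\<exists>\<alpha>. composition n \<alpha> \<and> I \<alpha> = S"
  using assms
proof (induction n arbitrary: S rule: less_induct)
  case (less n)
  show ?case
  proof (cases "S = {}")
    case True
    then show ?thesis using less.prems by (intro exI[of _ "[n]"]) (auto simp: composition_def I_def)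
  next
    case False
    have fin: "finite S" using less.prems finite_subset by blast
    define s where "s = Max S"
    have s: "s \<in> S" using False fin by (simp add: s_def)
    have lt: "t < s" if "t \<in> S - {s}" for t
      using that fin unfolding s_def by (metis DiffE Max_ge insertCI le_neq_implies_less)
    have "\<exists>\<alpha>. composition s \<alpha> \<and> I \<alpha> = S - {s}"
      by (rule less.IH) (use s less.prems lt in fastforce)+
    then obtain \<alpha> where \<alpha>: "composition s \<alpha>" "I \<alpha> = S - {s}" by blast
    have "s \<ge> 1" "s < n" using s less.prems by auto
    then have "composition n (\<alpha> @ [n - s])" "\<alpha> \<noteq> []"
      using \<alpha>(1) by (auto simp: composition_def)
    moreover have "sum_list \<alpha> = s" using \<alpha>(1) by (simp add: composition_def)
    ultimately show ?thesis using I_append \<alpha>(2) s by (metis insert_Diff)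
  qed
qed

lemma I_subset:
  assumes "composition n \<alpha>"
  shows "I \<alpha> \<subseteq> {1..<n}"
proof
  fix x assume "x \<in> I \<alpha>"
  then obtain j where j: "x = sum_list (take j \<alpha>)" "1 \<le> j" "j < length \<alpha>" by (auto simp: I_def)
  have "n = sum_list (take j \<alpha> @ drop j \<alpha>)" using assms by (simp add: composition_def)
  also have "\<dots> = x + sum_list (drop j \<alpha>)" using j by (simp only: sum_list_append)
  finally have n: "n = x + sum_list (drop j \<alpha>)" .
  \<comment> \<open>Since 1 \<le> j < \<open>length \<alpha>\<close>, both pieces of the split at j
    are nonempty, which makes both bounds on x strict.\<close>
  have pos: "0 < sum_list xs" if "xs \<noteq> []" "set xs \<subseteq> set \<alpha>" for xs
    using that assms by (cases xs) (auto simp: composition_def)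
  have "0 < x" unfolding j(1) by (rule pos) (use j in \<open>auto dest: in_set_takeD\<close>)
  moreover have "0 < sum_list (drop j \<alpha>)" by (rule pos) (use j in \<open>auto dest: in_set_dropD\<close>)
  ultimately show "x \<in> {1..<n}" using n by simp
qed

lemma one_in_I_iff:
  assumes "composition n \<alpha>" "n \<ge> 2"
  shows "1 \<in> I \<alpha> \<longleftrightarrow> hd \<alpha> = 1"
proof -
  obtain a \<beta> where \<alpha>: "\<alpha> = a # \<beta>" "a > 0"
    using assms by (cases \<alpha>) (auto simp: composition_def)
  show ?thesis
  proof
    assume "1 \<in> I \<alpha>"
    then obtain j where j: "1 = sum_list (take j \<alpha>)" "1 \<le> j" by (auto simp: I_def)
    then obtain i where "1 = a + sum_list (take i \<beta>)" using \<alpha> by (cases j) auto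
    then have "a = 1" using \<alpha>(2) by linarith
    then show "hd \<alpha> = 1" using \<alpha> by simp
  next
    assume "hd \<alpha> = 1"
    \<comment> \<open>The bound n \<ge> 2 excludes [1], which starts with 1 but has no proper
      partial sum.\<close>
    moreover from this have "\<beta> \<noteq> []" using assms \<alpha> by (auto simp: composition_def)
    ultimately show "1 \<in> I \<alpha>" using \<alpha> unfolding I_def
      by (auto intro!: exI[of _ 1])
  qed
qed

text \<open>By \<open>one_in_I_iff\<close>, a first part greater than 1 means that 1 is not a
  partial sum. For n = 1 both conditions always hold, as I \<alpha> is empty.\<close>

lemma shifted_qsym_eq:
  assumes "n \<ge> 1"
  shows "shifted_qsym n = {\<theta> \<alpha> | \<alpha>. composition n \<alpha> \<and> I \<alpha> \<subseteq> {2..<n}}"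
proof -
  have "(n \<le> 1 \<or> hd \<alpha> > 1) \<longleftrightarrow> I \<alpha> \<subseteq> {2..<n}" if \<alpha>: "composition n \<alpha>" for \<alpha>
  proof (cases "n \<ge> 2")
    case True
    have "hd \<alpha> > 0" using \<alpha> True by (cases \<alpha>) (auto simp: composition_def)
    then have "hd \<alpha> > 1 \<longleftrightarrow> 1 \<notin> I \<alpha>" using one_in_I_iff[OF \<alpha> True] by auto
    also have "\<dots> \<longleftrightarrow> I \<alpha> \<subseteq> {2..<n}"
      using I_subset[OF \<alpha>] by (force simp: subset_iff numeral_2_eq_2 le_less Suc_le_eq)
    finally show ?thesis using True by simp
  next
    case False
    then show ?thesis using I_subset[OF \<alpha>] by auto
  qed
  then show ?thesis unfolding shifted_qsym_def by blast
qed

section \<open>The block basis\<close>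

text \<open>The cut to {2..<n} keeps exactly what the condition in \<theta> \<alpha> can test when I
  \<alpha> \<subseteq> {2..<n}: it drops 1, which T may contain, and n, which may arise as a
  successor.\<close>

definition trace :: "nat \<Rightarrow> nat set \<Rightarrow> nat set" where
  "trace n T = (T \<union> Suc ` T) \<inter> {2..<n}"

definition traces :: "nat \<Rightarrow> nat set set" where
  "traces n = trace n ` Pow {1..<n}"

definition block :: "nat \<Rightarrow> nat set \<Rightarrow> series" where
  "block n U = (\<Sum>\<beta> | composition n \<beta> \<and> trace n (I \<beta>) = U. smul (2 ^ length \<beta>) (M \<beta>))"

lemma finite_traces: "finite (traces n)"
  by (simp add: traces_def)

lemma trace_I: "composition n \<beta> \<Longrightarrow> trace n (I \<beta>) \<in> traces n"
  unfolding traces_def using I_subset by blast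

lemma traces_subset: "U \<in> traces n \<Longrightarrow> U \<subseteq> {2..<n}"
  by (auto simp: traces_def trace_def)

text \<open>For such \<alpha>, whether \<beta> contributes depends only on the trace of I \<beta>,
  so the sum can be grouped by traces.\<close>

lemma \<theta>_eq_sum_block:
  assumes "composition n \<alpha>" "I \<alpha> \<subseteq> {2..<n}"
  shows "\<theta> \<alpha> = (\<Sum>U | U \<in> traces n \<and> I \<alpha> \<subseteq> U. block n U)"
proof -
  let ?C = "{\<beta>. composition n \<beta> \<and> I \<alpha> \<subseteq> trace n (I \<beta>)}"
  have fin: "finite ?C" by (rule finite_subset[OF _ finite_compositions[of n]]) auto
  have "\<theta> \<alpha> = (\<Sum>\<beta>\<in>?C. smul (2 ^ length \<beta>) (M \<beta>))"
    unfolding \<theta>_def by (rule sum.cong) (use assms in \<open>auto simp: composition_def trace_def\<close>)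
  also have "\<dots> = (\<Sum>U | U \<in> traces n \<and> I \<alpha> \<subseteq> U.
      \<Sum>\<beta> | \<beta> \<in> ?C \<and> trace n (I \<beta>) = U. smul (2 ^ length \<beta>) (M \<beta>))"
    by (rule sum.group[symmetric]) (use fin finite_traces trace_I in auto)
  also have "\<dots> = (\<Sum>U | U \<in> traces n \<and> I \<alpha> \<subseteq> U. block n U)"
    unfolding block_def by (intro sum.cong refl) auto
  finally show ?thesis .
qed

text \<open>Inclusion-exclusion as an induction from large traces to small ones: subtract from one
  \<theta> \<alpha> the blocks of all strictly larger traces.\<close>

lemma block_in_\<Xi>:
  assumes "n \<ge> 1" "U \<in> traces n"
  shows "block n U \<in> \<Xi> n"
  using assms(2)
proof (induction "card ({2..<n} - U)" arbitrary: U rule: less_induct)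
  case less
  note U = traces_subset[OF less.prems]
  then have "U \<subseteq> {1..<n}" by force
  \<comment> \<open>Here U is I \<alpha> itself, not the trace of I \<alpha>.\<close>
  then obtain \<alpha> where \<alpha>: "composition n \<alpha>" "I \<alpha> = U"
    using composition_with_partial_sums assms(1) by blast
  let ?V = "{V. V \<in> traces n \<and> U \<subset> V}"
  have "{V. V \<in> traces n \<and> U \<subseteq> V} = insert U ?V" using less.prems by auto
  moreover have "finite ?V" by (rule finite_subset[OF _ finite_traces[of n]]) auto
  ultimately have "\<theta> \<alpha> = block n U + (\<Sum>V\<in>?V. block n V)"
    using \<theta>_eq_sum_block[OF \<alpha>(1)] \<alpha>(2) U by simp
  then have "block n U = \<theta> \<alpha> - (\<Sum>V\<in>?V. block n V)" by simp
  moreover have "\<theta> \<alpha> \<in> \<Xi> n"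
    unfolding \<Xi>_def shifted_qsym_eq[OF assms(1)] using \<alpha> U by (intro Z.span_base) blast
  moreover have "block n V \<in> \<Xi> n" if "V \<in> ?V" for V
  proof (rule less.hyps)
    have "V \<subseteq> {2..<n}" using that traces_subset by blast
    then show "card ({2..<n} - V) < card ({2..<n} - U)"
      using that U by (intro psubset_card_mono) auto
  qed (use that in auto)
  ultimately show ?case unfolding \<Xi>_def by (auto intro!: Z.span_diff Z.span_sum)
qed

lemma \<Xi>_eq_span_blocks:
  assumes "n \<ge> 1"
  shows "\<Xi> n = Z.span (block n ` traces n)"
proof
  have "shifted_qsym n \<subseteq> Z.span (block n ` traces n)"
  proof
    fix f assume "f \<in> shifted_qsym n"
    then obtain \<alpha> where "composition n \<alpha>" "I \<alpha> \<subseteq> {2..<n}" "f = \<theta> \<alpha>"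
      unfolding shifted_qsym_eq[OF assms] by blast
    then have "f = (\<Sum>U | U \<in> traces n \<and> I \<alpha> \<subseteq> U. block n U)" by (simp add: \<theta>_eq_sum_block)
    also have "\<dots> \<in> Z.span (block n ` traces n)"
      by (rule Z.span_sum, rule Z.span_base) simp
    finally show "f \<in> Z.span (block n ` traces n)" .
  qed
  then show "\<Xi> n \<subseteq> Z.span (block n ` traces n)"
    unfolding \<Xi>_def by (intro Z.span_minimal Z.subspace_span)
  show "Z.span (block n ` traces n) \<subseteq> \<Xi> n"
    using block_in_\<Xi>[OF assms] unfolding \<Xi>_def
    by (intro Z.span_minimal Z.subspace_span) auto
qed

lemma block_packed_monomial:
  assumes "composition n \<beta>"
  shows "block n U (packed_monomial \<beta>) = (if trace n (I \<beta>) = U then 2 ^ length \<beta> else 0)"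
proof -
  let ?C = "{\<gamma>. composition n \<gamma> \<and> trace n (I \<gamma>) = U}"
  have fin: "finite ?C" by (rule finite_subset[OF _ finite_compositions[of n]]) auto
  have "block n U (packed_monomial \<beta>) = (\<Sum>\<gamma>\<in>?C. 2 ^ length \<gamma> * M \<gamma> (packed_monomial \<beta>))"
    by (simp add: block_def sum_fun_apply smul_def)
  also have "\<dots> = (\<Sum>\<gamma>\<in>?C. if \<gamma> = \<beta> then 2 ^ length \<gamma> else 0)"
    using assms by (intro sum.cong refl) (auto simp: composition_def M_packed_monomial)
  also have "\<dots> = (if trace n (I \<beta>) = U then 2 ^ length \<beta> else 0)"
    using fin assms by simp
  finally show ?thesis .
qed

lemma traces_witness:
  assumes "n \<ge> 1" "U \<in> traces n"
  obtains \<beta> where "composition n \<beta>" "trace n (I \<beta>) = U"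
proof -
  obtain T where "T \<subseteq> {1..<n}" "U = trace n T" using assms(2) unfolding traces_def by blast
  then show ?thesis using composition_with_partial_sums[OF assms(1)] that by blast
qed

text \<open>The packed monomial of a composition with trace U occurs in the block of U and in no
  other. Injectivity makes the number of blocks equal the number of traces.\<close>

lemma inj_on_block:
  assumes "n \<ge> 1"
  shows "inj_on (block n) (traces n)"
proof
  fix U V assume U: "U \<in> traces n" and eq: "block n U = block n V"
  obtain \<beta> where "composition n \<beta>" "trace n (I \<beta>) = U" using traces_witness[OF assms U] .
  then show "U = V"
    using block_packed_monomial[of n \<beta> U] block_packed_monomial[of n \<beta> V] eq
    by (simp split: if_splits)
qed

lemma independent_blocks:
  assumes "n \<ge> 1"
  shows "\<not> Z.dependent (block n ` traces n)"
proof
  assume "Z.dependent (block n ` traces n)"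
  then obtain u U where U: "U \<in> traces n" "u (block n U) \<noteq> 0"
    and z: "(\<Sum>x\<in>block n ` traces n. smul (u x) x) = 0"
    unfolding Z.dependent_finite[OF finite_imageI[OF finite_traces]] by auto
  \<comment> \<open>Evaluating the relation at the packed monomial of \<beta> removes every block
    except that of U, whose coefficient there is a power of 2.\<close>
  obtain \<beta> where \<beta>: "composition n \<beta>" "trace n (I \<beta>) = U" using traces_witness[OF assms U(1)] .
  have "0 = (\<Sum>x\<in>block n ` traces n. smul (u x) x) (packed_monomial \<beta>)" using z by simp
  also have "\<dots> = (\<Sum>V\<in>traces n. u (block n V) * block n V (packed_monomial \<beta>))"
    by (simp add: sum_fun_apply smul_def sum.reindex[OF inj_on_block[OF assms]])
  also have "\<dots> = (\<Sum>V\<in>traces n. if V = U then u (block n U) * 2 ^ length \<beta> else 0)"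
    using \<beta> by (intro sum.cong) (auto simp: block_packed_monomial)
  also have "\<dots> = u (block n U) * 2 ^ length \<beta>"
    using U(1) by (simp add: finite_traces)
  finally show False using U(2) by simp
qed

lemma \<pi>_eq_card_traces:
  assumes "n \<ge> 1"
  shows "\<pi> n = enat (card (traces n))"
  unfolding \<pi>_def \<Xi>_eq_span_blocks[OF assms]
  using rank_span[OF finite_imageI[OF finite_traces] independent_blocks[OF assms]]
  by (simp add: card_image[OF inj_on_block[OF assms]])

section \<open>Counting traces\<close>

text \<open>Low and high traces come from sets without and with n - 1. The two families may overlap:
  for n \<ge> 3, {n - 2} and {n - 2, n - 1} have the same trace. Their sizes therefore cannot simply
  be added.\<close>

definition low_traces :: "nat \<Rightarrow> nat set set" where
  "low_traces n = trace n ` Pow {1..<n - 1}"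

definition high_traces :: "nat \<Rightarrow> nat set set" where
  "high_traces n = (\<lambda>T. trace n (insert (n - 1) T)) ` Pow {1..<n - 1}"

lemma traces_eq_Un:
  assumes "n \<ge> 2"
  shows "traces n = low_traces n \<union> high_traces n"
proof -
  have "{1..<n} = insert (n - 1) {1..<n - 1}" using assms by auto
  then show ?thesis
    by (simp only: traces_def low_traces_def high_traces_def Pow_insert image_Un image_image)
qed

text \<open>The only new position is n; as n is not in T, it can be reached only as the successor of
  n - 1.\<close>

lemma trace_Suc:
  assumes "n \<ge> 2" "T \<subseteq> {1..<n}"
  shows "trace (Suc n) T = (if n - 1 \<in> T then insert n (trace n T) else trace n T)"
proof -
  have "{2..<Suc n} = insert n {2..<n}" using assms by auto
  moreover have "n \<notin> T" using assms by auto
  moreover have "n \<in> Suc ` T \<longleftrightarrow> n - 1 \<in> T" using assms by (cases n) auto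
  ultimately show ?thesis unfolding trace_def by auto
qed

lemma trace_Suc_insert:
  assumes "n \<ge> 2"
  shows "trace (Suc n) (insert n T) = insert n (trace n T)"
  using assms unfolding trace_def by auto

text \<open>Split the subsets of {1..<n} by membership of n - 1, which decides whether n enters the
  trace. Unlike the low and high traces of n, the two resulting families are disjoint.\<close>

lemma low_traces_Suc:
  assumes "n \<ge> 2"
  shows "low_traces (Suc n) = low_traces n \<union> insert n ` high_traces n"
proof -
  have e: "{1..<n} = insert (n - 1) {1..<n - 1}" using assms by auto
  have T: "trace (Suc n) T = trace n T"
      "trace (Suc n) (insert (n - 1) T) = insert n (trace n (insert (n - 1) T))"
    if "T \<in> Pow {1..<n - 1}" for T
  proof -
    have "T \<subseteq> {1..<n}" "insert (n - 1) T \<subseteq> {1..<n}" "n - 1 \<notin> T" using that e by auto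
    then show "trace (Suc n) T = trace n T"
      "trace (Suc n) (insert (n - 1) T) = insert n (trace n (insert (n - 1) T))"
      by (simp_all only: trace_Suc[OF assms] if_False insertI1 if_True)
  qed
  have "low_traces (Suc n) = trace (Suc n) ` Pow {1..<n}" by (simp add: low_traces_def)
  also have "\<dots> = trace (Suc n) ` Pow {1..<n - 1}
      \<union> (\<lambda>T. trace (Suc n) (insert (n - 1) T)) ` Pow {1..<n - 1}"
    by (simp only: e Pow_insert image_Un image_image)
  also have "trace (Suc n) ` Pow {1..<n - 1} = low_traces n"
    unfolding low_traces_def by (intro image_cong T refl)
  also have "(\<lambda>T. trace (Suc n) (insert (n - 1) T)) ` Pow {1..<n - 1} = insert n ` high_traces n"
    unfolding high_traces_def image_image by (intro image_cong T refl)
  finally show ?thesis .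
qed

lemma high_traces_Suc:
  assumes "n \<ge> 2"
  shows "high_traces (Suc n) = insert n ` traces n"
  using assms by (simp add: high_traces_def traces_def image_image trace_Suc_insert)

text \<open>The part \<open>insert n\<close> applied to high traces is absorbed, since high traces
  are traces; what remains is a disjoint union.\<close>

lemma traces_Suc:
  assumes "n \<ge> 2"
  shows "traces (Suc n) = low_traces n \<union> insert n ` traces n"
  using traces_eq_Un[of "Suc n"] traces_eq_Un[OF assms] low_traces_Suc[OF assms]
    high_traces_Suc[OF assms] assms by auto

text \<open>As n lies in no member of A or B, inserting it is injective on B and yields sets outside
  A.\<close>

lemma card_Un_insert_image:
  assumes "finite A" "finite B" "\<forall>X \<in> A \<union> B. n \<notin> X"
  shows "card (A \<union> insert n ` B) = card A + card B"
proof -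
  have "inj_on (insert n) B" using assms by (auto simp: inj_on_def)
  moreover have "A \<inter> insert n ` B = {}" using assms by auto
  ultimately show ?thesis using assms by (simp add: card_Un_disjoint card_image)
qed

lemma parts_of_traces:
  assumes "n \<ge> 2"
  shows "finite (low_traces n)" "finite (high_traces n)"
    "\<forall>X \<in> low_traces n \<union> traces n. n \<notin> X" "\<forall>X \<in> low_traces n \<union> high_traces n. n \<notin> X"
  using finite_traces[of n] traces_subset[of _ n] traces_eq_Un[OF assms] by fastforce+

lemma card_traces_Suc:
  assumes "n \<ge> 2"
  shows "card (traces (Suc n)) = card (low_traces n) + card (traces n)"
  using card_Un_insert_image parts_of_traces[OF assms] finite_traces traces_Suc[OF assms] by metis

lemma card_low_traces_Suc:
  assumes "n \<ge> 2"
  shows "card (low_traces (Suc n)) = card (low_traces n) + card (high_traces n)"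
  using card_Un_insert_image parts_of_traces[OF assms] low_traces_Suc[OF assms] by metis

lemma card_high_traces_Suc:
  assumes "n \<ge> 1"
  shows "card (high_traces (Suc n)) = card (traces n)"
proof (cases "n = 1")
  \<comment> \<open>The case n = 1 starts the small values and is also needed for the recurrence at
    n = 5.\<close>
  case True
  then show ?thesis by (simp add: high_traces_def traces_def trace_def)
next
  case False
  then have n: "n \<ge> 2" using assms by simp
  show ?thesis
    using card_Un_insert_image[of "{}" "traces n" n] parts_of_traces(3)[OF n] finite_traces
      high_traces_Suc[OF n] by simp
qed

lemma card_traces_small:
  "card (traces 1) = 1" "card (traces 2) = 1" "card (traces 3) = 2" "card (traces 4) = 4"
proof -
  show 1: "card (traces 1) = 1" by (simp add: traces_def trace_def)
  have "traces 2 = {{}}" by (auto simp: traces_def trace_def)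
  then show 2: "card (traces 2) = 1" by simp
  have low2: "card (low_traces 2) = 1" by (simp add: low_traces_def)
  have "card (traces (Suc 2)) = 2" using card_traces_Suc[of 2] 2 low2 by simp
  then show 3: "card (traces 3) = 2" by simp
  have "card (high_traces (Suc 1)) = 1" using card_high_traces_Suc[of 1] 1 by simp
  then have "card (high_traces 2) = 1" by (simp add: numeral_2_eq_2)
  then have "card (low_traces (Suc 2)) = 2" using card_low_traces_Suc[of 2] low2 by simp
  then have "card (traces (Suc 3)) = 4" using card_traces_Suc[of 3] 3 by simp
  then show "card (traces 4) = 4" by simp
qed

lemma card_traces_recurrence:
  assumes "n \<ge> 5"
  shows "card (traces n) = card (traces (n - 1)) + card (traces (n - 2)) + card (traces (n - 4))"
proof -
  define k where "k = n - 5"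
  have n: "n = Suc (Suc (Suc (Suc (Suc k))))" using assms by (simp add: k_def)
  have low: "card (low_traces (Suc (Suc m))) = card (low_traces (Suc m)) + card (traces m)"
    if "m \<ge> 1" for m
    using that card_low_traces_Suc[of "Suc m"] card_high_traces_Suc[of m] by simp
  \<comment> \<open>Write t and l for the numbers of traces and low traces. Then t(n) = t(n-1) +
    l(n-1) and l(n-1) = l(n-3) + t(n-4) + t(n-3), where l(n-3) + t(n-3) = t(n-2).\<close>
  show ?thesis
    using card_traces_Suc[of "Suc (Suc k)"] card_traces_Suc[of "Suc (Suc (Suc (Suc k)))"]
      low[of "Suc k"] low[of "Suc (Suc k)"] by (simp add: n)
qed

theorem theorem4p3:
  shows "\<pi> 1 = 1 \<and> \<pi> 2 = 1 \<and> \<pi> 3 = 2 \<and> \<pi> 4 = 4 \<and>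
    (\<forall>n\<ge>5. \<pi> n = \<pi> (n - 1) + \<pi> (n - 2) + \<pi> (n - 4))"
proof (intro conjI allI impI)
  show "\<pi> 1 = 1" "\<pi> 2 = 1" "\<pi> 3 = 2" "\<pi> 4 = 4"
    by (simp_all only: \<pi>_eq_card_traces card_traces_small)
      (simp_all add: \<pi>_eq_card_traces card_traces_small one_enat_def numeral_eq_enat)
  fix n :: nat assume "5 \<le> n"
  then show "\<pi> n = \<pi> (n - 1) + \<pi> (n - 2) + \<pi> (n - 4)"
    by (simp add: \<pi>_eq_card_traces card_traces_recurrence)
qed

end
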